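(* For all integers $r\ge 2$ and $t\ge 2$, there exist infinitely many $r$-edge-connected $r$-regular $t$-uniform hypergraphs which do not have a Berge $k$-factor for any integer $k$ with $k>\frac{2}{t}r$.
   Context: A hypergraph has a finite vertex set and a finite multiset of edges, each a vertex subset of size at least two; it is $t$-uniform if every edge has exactly $t$ vertices, and $r$-regular if every vertex lies in exactly $r$ edges. A Berge-path is an alternating sequence of distinct vertices and distinct edges $v_1,e_1,\dots,e_l,v_{l+1}$ with $\{v_i,v_{i+1}\}\subseteq e_i$; the hypergraph is $\lambda$-edge-connected if after deleting any at most $\lambda-1$ edges every two vertices are still joined by a Berge-path. A Berge $k$-factor is a spanning subhypergraph $\mathcal{H}'$ (same vertex set, sub-multiset of edges) for which there is a $k$-regular graph $G$ (multiple edges allowed) on the same vertex set and a bijection $\phi:E(G)\to E(\mathcal{H}')$ with $e\subseteq\phi(e)$ for all $e$. *)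

theory Defs
  imports Complex_Main "HOL-Library.Multiset"
begin

record 'a hypergraph =
  verts :: "'a set"
  edges :: "'a set multiset"

definition is_hypergraph :: "'a hypergraph \<Rightarrow> bool" where
  "is_hypergraph H \<longleftrightarrow>
     finite (verts H) \<and> (\<forall>e \<in># edges H. e \<subseteq> verts H \<and> card e \<ge> 2)"

definition uniform :: "nat \<Rightarrow> 'a hypergraph \<Rightarrow> bool" where
  "uniform t H \<longleftrightarrow> (\<forall>e \<in># edges H. card e = t)"

definition regular :: "nat \<Rightarrow> 'a hypergraph \<Rightarrow> bool" where
  "regular r H \<longleftrightarrow> (\<forall>v \<in> verts H. size {# e \<in># edges H. v \<in> e #} = r)"

text \<open>The individual members of a multiset of edges: parallel edges become distinct
  pairs sharing the same underlying vertex set, which is the first component.\<close>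

definition edge_copies :: "'a set multiset \<Rightarrow> ('a set \<times> nat) set" where
  "edge_copies E = {(e, i). i < count E e}"

text \<open>The path \<open>v\<^sub>1, e\<^sub>1, \<dots>, e\<^sub>l, v\<^bsub>l+1\<^esub>\<close> is given by the list of its vertices and the list
  of its edges. Parallel edges are distinct; \<open>l = 0\<close> is allowed.\<close>

definition berge_path ::
  "'a hypergraph \<Rightarrow> 'a \<Rightarrow> 'a list \<Rightarrow> ('a set \<times> nat) list \<Rightarrow> 'a \<Rightarrow> bool" where
  "berge_path H u vs es v \<longleftrightarrow>
     length vs = length es + 1 \<and> hd vs = u \<and> last vs = v \<and>
     distinct vs \<and> set vs \<subseteq> verts H \<and>
     distinct es \<and> set es \<subseteq> edge_copies (edges H) \<and>
     (\<forall>i < length es. {vs ! i, vs ! (i + 1)} \<subseteq> fst (es ! i))"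

definition connected_hypergraph :: "'a hypergraph \<Rightarrow> bool" where
  "connected_hypergraph H \<longleftrightarrow>
     (\<forall>u \<in> verts H. \<forall>v \<in> verts H. \<exists>vs es. berge_path H u vs es v)"

definition delete_edges :: "'a hypergraph \<Rightarrow> 'a set multiset \<Rightarrow> 'a hypergraph" where
  "delete_edges H D = H\<lparr>edges := edges H - D\<rparr>"

text \<open>At most \<open>l - 1\<close> deleted edges is written \<open>size D < l\<close>, avoiding truncated subtraction.\<close>

definition edge_connected :: "nat \<Rightarrow> 'a hypergraph \<Rightarrow> bool" where
  "edge_connected l H \<longleftrightarrow>
     (\<forall>D. D \<subseteq># edges H \<and> size D < l \<longrightarrow> connected_hypergraph (delete_edges H D))"

text \<open>A loopless multigraph is a \<open>2\<close>-uniform hypergraph.\<close>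

definition is_multigraph :: "'a hypergraph \<Rightarrow> bool" where
  "is_multigraph G \<longleftrightarrow> is_hypergraph G \<and> uniform 2 G"

definition spanning_subhypergraph :: "'a hypergraph \<Rightarrow> 'a hypergraph \<Rightarrow> bool" where
  "spanning_subhypergraph H' H \<longleftrightarrow> verts H' = verts H \<and> edges H' \<subseteq># edges H"

definition berge_factor :: "nat \<Rightarrow> 'a hypergraph \<Rightarrow> 'a hypergraph \<Rightarrow> bool" where
  "berge_factor k H' H \<longleftrightarrow> spanning_subhypergraph H' H \<and>
     (\<exists>G \<phi>. is_multigraph G \<and> verts G = verts H' \<and> regular k G \<and>
        bij_betw \<phi> (edge_copies (edges G)) (edge_copies (edges H')) \<and>
        (\<forall>x \<in> edge_copies (edges G). fst x \<subseteq> fst (\<phi> x)))"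

definition isomorphic :: "'a hypergraph \<Rightarrow> 'b hypergraph \<Rightarrow> bool" where
  "isomorphic H H' \<longleftrightarrow>
     (\<exists>f. bij_betw f (verts H) (verts H') \<and> image_mset ((`) f) (edges H) = edges H')"

end

theory Submission
  imports Defs "HOL-Library.Disjoint_Sets"
begin

text \<open>Double counting of incidences shows that a Berge \<open>k\<close>-factor of an \<open>r\<close>-regular \<open>t\<close>-uniform
  hypergraph on \<open>n > 0\<close> vertices has \<open>k n / 2\<close> edges, out of \<open>r n / t\<close>, so \<open>k \<le> 2 r / t\<close> always
  holds and any infinite family of \<open>r\<close>-edge-connected hypergraphs will do.

  Such a family comes from three partitions of the vertex set into \<open>t\<close>-sets, any two of which
  have only the trivial common coarsening, taken with multiplicities \<open>w\<^sub>1 + w\<^sub>2 + w\<^sub>3 = r\<close>,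
  \<open>2 w\<^sub>i \<le> r\<close>. If a cut \<open>X\<close> splits a block of each partition, at least \<open>r\<close> edges cross it. If \<open>X\<close>
  is a union of blocks of one partition, then \<open>t\<close> divides \<open>card X\<close>, so each of the other two
  partitions has at least two split blocks, which gives at least \<open>2 (r - w\<^sub>i) \<ge> r\<close> crossing edges.
  On \<open>\<int>/tm\<close> with \<open>m \<equiv> 1 (mod t)\<close> one can take the intervals of length \<open>t\<close> starting at the
  multiples of \<open>t\<close>, their translates by \<open>-1\<close>, and the cosets of the subgroup generated by \<open>m\<close>.\<close>

section \<open>Counting edges\<close>

lemma card_edge_copies: "card (edge_copies E) = size E"
proof -
  have "edge_copies E = Sigma (set_mset E) (\<lambda>e. {..<count E e})"
    by (auto simp: edge_copies_def count_inI)
  then show ?thesis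
    by (simp add: size_multiset_overloaded_eq)
qed

lemma sum_degrees:
  assumes "finite V" and "\<forall>e \<in># E. e \<subseteq> V"
  shows "(\<Sum>v\<in>V. size {#e \<in># E. v \<in> e#}) = (\<Sum>e\<in>#E. card e)"
  using assms(2)
proof (induction E)
  case (add e E)
  have "(\<Sum>v\<in>V. size {#e' \<in># add_mset e E. v \<in> e'#})
      = (\<Sum>v\<in>V. size {#e' \<in># E. v \<in> e'#} + (if v \<in> e then 1 else 0))"
    by (intro sum.cong) auto
  also have "\<dots> = (\<Sum>e\<in>#E. card e) + card e"
    using add assms(1) by (simp add: sum.distrib sum.If_cases Int_absorb1)
  finally show ?case by simp
qed auto

lemma regular_uniform_size:
  assumes "is_hypergraph H" and "regular r H" and "uniform t H"
  shows "r * card (verts H) = t * size (edges H)"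
proof -
  have "r * card (verts H) = (\<Sum>v\<in>verts H. size {#e \<in># edges H. v \<in> e#})"
    using assms(2) by (simp add: regular_def)
  also have "\<dots> = (\<Sum>e\<in>#edges H. card e)"
    using assms(1) by (intro sum_degrees) (auto simp: is_hypergraph_def)
  also have "\<dots> = (\<Sum>e\<in>#edges H. t)"
    using assms(3) by (intro arg_cong[of _ _ sum_mset] image_mset_cong) (simp add: uniform_def)
  finally show ?thesis by simp
qed

lemma berge_factor_bound:
  assumes H: "is_hypergraph H" "regular r H" "uniform t H" "verts H \<noteq> {}"
    and "berge_factor k H' H"
  shows "k * t \<le> 2 * r"
proof -
  obtain G \<phi> where G: "is_hypergraph G" "uniform 2 G" "verts G = verts H" "regular k G"
    and \<phi>: "bij_betw \<phi> (edge_copies (edges G)) (edge_copies (edges H'))"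
    and sub: "edges H' \<subseteq># edges H"
    using assms(5) by (auto simp: berge_factor_def spanning_subhypergraph_def is_multigraph_def)
  \<comment> \<open>The bijection \<open>\<phi>\<close> gives \<open>G\<close> as many edges as
    \<open>H'\<close>, and \<open>H'\<close> has at most as many as \<open>H\<close>.\<close>
  have "size (edges G) \<le> size (edges H)"
    using bij_betw_same_card[OF \<phi>] size_mset_mono[OF sub] by (simp add: card_edge_copies)
  then have "t * (2 * size (edges G)) \<le> 2 * (t * size (edges H))"
    by simp
  moreover have "k * card (verts H) = 2 * size (edges G)"
    using regular_uniform_size[OF G(1,4,2)] G(3) by simp
  moreover have "r * card (verts H) = t * size (edges H)"
    using regular_uniform_size[OF H(1-3)] .
  ultimately have "t * (k * card (verts H)) \<le> 2 * (r * card (verts H))"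
    by metis
  then have "(k * t) * card (verts H) \<le> (2 * r) * card (verts H)"
    by (simp only: mult_ac)
  moreover have "card (verts H) > 0"
    using H(1,4) by (simp add: is_hypergraph_def card_gt_0_iff)
  ultimately show ?thesis by simp
qed

section \<open>Edge-connectivity and cuts\<close>

text \<open>If \<open>y\<close> is already on the path, the path is truncated there. Otherwise it is
  cut at its first vertex in \<open>e\<close>, and \<open>e\<close> leads from there to
  \<open>y\<close>.\<close>

lemma berge_path_extend:
  assumes "berge_path H u vs es x" and "e \<in># edges H" and "x \<in> e" and "y \<in> e"
    and "y \<in> verts H"
  shows "\<exists>vs es. berge_path H u vs es y"
proof -
  have len: "length vs = length es + 1" and hd: "hd vs = u" and last: "last vs = x"
    and dv: "distinct vs" and V: "set vs \<subseteq> verts H"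
    and de: "distinct es" and E: "set es \<subseteq> edge_copies (edges H)"
    and inc: "\<And>i. i < length es \<Longrightarrow> vs ! i \<in> fst (es ! i) \<and> vs ! (i + 1) \<in> fst (es ! i)"
    using assms(1) by (auto simp: berge_path_def)
  show ?thesis
  proof (cases "y \<in> set vs")
    case True
    then obtain i where i: "i < length vs" "vs ! i = y"
      by (auto simp: in_set_conv_nth)
    have "last (take (Suc i) vs) = y"
      using i by (simp add: take_Suc_conv_app_nth)
    then have "berge_path H u (take (Suc i) vs) (take i es) y"
      unfolding berge_path_def
      using i len hd dv V de E inc
      by (auto simp: min_def dest!: in_set_takeD)
    then show ?thesis by blast
  next
    case False
    define i where "i = (LEAST i. i < length vs \<and> vs ! i \<in> e)"
    have "length es < length vs \<and> vs ! length es \<in> e"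
      using len last assms(3) by (simp add: last_conv_nth flip: length_greater_0_conv)
    then have i: "i < length vs" "vs ! i \<in> e"
      unfolding i_def by (metis (mono_tags, lifting) LeastI)+
    have least: "vs ! j \<notin> e" if "j < i" for j
      using not_less_Least[of j "\<lambda>i. i < length vs \<and> vs ! i \<in> e"] that i(1)
      by (auto simp: i_def)
    have new: "(e, 0) \<notin> set (take i es)"
    proof
      assume "(e, 0) \<in> set (take i es)"
      then obtain j where "j < i" "j < length es" "es ! j = (e, 0)"
        by (auto simp: in_set_conv_nth)
      then show False using inc[of j] least[of j] by simp
    qed
    have "berge_path H u (take (Suc i) vs @ [y]) (take i es @ [(e, 0)]) y"
      unfolding berge_path_def
    proof (intro conjI allI impI)
      fix j assume j: "j < length (take i es @ [(e, 0)])"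
      show "{(take (Suc i) vs @ [y]) ! j, (take (Suc i) vs @ [y]) ! (j + 1)}
          \<subseteq> fst ((take i es @ [(e, 0)]) ! j)"
      proof (cases "j < i")
        case True
        then show ?thesis using i(1) len inc[of j] by (simp add: nth_append)
      next
        case False
        then have "j = i" using j i(1) len by simp
        then show ?thesis using i len assms(4) by (simp add: nth_append)
      qed
    next
      show "hd (take (Suc i) vs @ [y]) = u"
        using i(1) hd by (cases vs) auto
      show "distinct (take (Suc i) vs @ [y])"
        using dv False by (auto dest!: in_set_takeD)
      show "set (take (Suc i) vs @ [y]) \<subseteq> verts H"
        using V assms(5) by (auto dest!: in_set_takeD)
      show "distinct (take i es @ [(e, 0)])"
        using de new by simp
      show "set (take i es @ [(e, 0)]) \<subseteq> edge_copies (edges H)"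
        using E assms(2) by (auto simp: edge_copies_def dest!: in_set_takeD)
    qed (use i len in auto)
    then show ?thesis by blast
  qed
qed

definition crosses :: "'a set \<Rightarrow> 'a set \<Rightarrow> bool" where
  "crosses X e \<longleftrightarrow> e \<inter> X \<noteq> {} \<and> e - X \<noteq> {}"

text \<open>The cut condition is applied to the set of vertices reachable from \<open>u\<close>: an
  edge crossing it would extend some path beyond it, so this set is all of
  \<open>verts H\<close>.\<close>

lemma connected_hypergraphI:
  assumes hyp: "\<forall>e \<in># edges H. e \<subseteq> verts H"
    and cut: "\<And>X. X \<subset> verts H \<Longrightarrow> X \<noteq> {} \<Longrightarrow> \<exists>e \<in># edges H. crosses X e"
  shows "connected_hypergraph H"
  unfolding connected_hypergraph_def
proof (intro ballI)
  fix u v assume u: "u \<in> verts H" and v: "v \<in> verts H"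
  define X where "X = {x \<in> verts H. \<exists>vs es. berge_path H u vs es x}"
  have "berge_path H u [u] [] u"
    using u by (simp add: berge_path_def)
  then have "X \<noteq> {}"
    using u by (auto simp: X_def)
  moreover have "\<not> crosses X e" if e: "e \<in># edges H" for e
  proof
    assume "crosses X e"
    then obtain x y where "x \<in> e" "x \<in> X" "y \<in> e" "y \<notin> X"
      by (auto simp: crosses_def)
    then show False
      using berge_path_extend[OF _ e \<open>x \<in> e\<close> \<open>y \<in> e\<close>] hyp e unfolding X_def by blast
  qed
  ultimately have "X = verts H"
    using cut[of X] by (auto simp: X_def)
  then show "\<exists>vs es. berge_path H u vs es v"
    using v by (auto simp: X_def)
qed

lemma edge_connectedI:
  assumes hyp: "\<forall>e \<in># edges H. e \<subseteq> verts H"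
    and cut: "\<And>X. X \<subset> verts H \<Longrightarrow> X \<noteq> {} \<Longrightarrow> l \<le> size {#e \<in># edges H. crosses X e#}"
  shows "edge_connected l H"
  unfolding edge_connected_def
proof (intro allI impI)
  fix D assume D: "D \<subseteq># edges H \<and> size D < l"
  show "connected_hypergraph (delete_edges H D)"
  proof (rule connected_hypergraphI)
    show "\<forall>e \<in># edges (delete_edges H D). e \<subseteq> verts (delete_edges H D)"
      using hyp by (auto simp: delete_edges_def dest: in_diffD)
  next
    fix X assume "X \<subset> verts (delete_edges H D)" and "X \<noteq> {}"
    then have "size D < size {#e \<in># edges H. crosses X e#}"
      using cut[of X] D by (simp add: delete_edges_def)
    \<comment> \<open>By size, \<open>D\<close> cannot contain all crossing edges; some crossing
      edge has larger multiplicity in \<open>H\<close> than in \<open>D\<close> and survives the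
      deletion.\<close>
    then have "\<not> {#e \<in># edges H. crosses X e#} \<subseteq># D"
      using size_mset_mono leD by blast
    then obtain e where "count D e < count {#e \<in># edges H. crosses X e#} e"
      by (auto simp: subseteq_mset_def not_le)
    then have "crosses X e" and "e \<in># edges H - D"
      by (auto simp: in_diff_count split: if_splits)
    then show "\<exists>e \<in># edges (delete_edges H D). crosses X e"
      by (auto simp: delete_edges_def)
  qed
qed

section \<open>Hypergraphs from three partitions\<close>

text \<open>An uncrossed block contributes 0 or \<open>t\<close> to \<open>card X\<close>, whereas a
  crossed block contributes strictly between 0 and \<open>t\<close>.\<close>

lemma card_mod_crossing:
  assumes "finite V" and P: "partition_on V P" and t: "\<forall>p \<in> P. card p = t" and "X \<subseteq> V"
  shows "card {p \<in> P. crosses X p} = 0 \<Longrightarrow> t dvd card X"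
    and "card {p \<in> P. crosses X p} = 1 \<Longrightarrow> \<not> t dvd card X"
proof -
  have fP: "finite P" and fin: "\<And>p. p \<in> P \<Longrightarrow> finite p"
    using P assms(1) finite_elements partition_onD1[OF P]
    by (auto intro: finite_subset)
  have "X = (\<Union>p\<in>P. p \<inter> X)"
    using partition_onD1[OF P] assms(4) by blast
  also have "card \<dots> = (\<Sum>p\<in>P. card (p \<inter> X))"
    using fP fin partition_onD2[OF P]
    by (intro card_UN_disjoint) (auto simp: disjoint_def)
  finally have sum: "card X = (\<Sum>p\<in>P. card (p \<inter> X))" .
  have dvd: "t dvd card (p \<inter> X)" if "p \<in> P" "\<not> crosses X p" for p
  proof -
    have "p \<inter> X = {} \<or> p \<inter> X = p"
      using that by (auto simp: crosses_def)
    then show ?thesis using t that by auto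
  qed
  show "t dvd card X" if "card {p \<in> P. crosses X p} = 0"
    using that fP dvd unfolding sum by (intro dvd_sum) auto
  show "\<not> t dvd card X" if one: "card {p \<in> P. crosses X p} = 1"
  proof
    assume "t dvd card X"
    obtain q where q: "{p \<in> P. crosses X p} = {q}"
      using one by (auto simp: card_1_singleton_iff)
    then have qP: "q \<in> P" and cq: "crosses X q" by auto
    have "card X = card (q \<inter> X) + (\<Sum>p\<in>P - {q}. card (p \<inter> X))"
      unfolding sum using fP qP by (simp add: sum.remove)
    moreover have "t dvd (\<Sum>p\<in>P - {q}. card (p \<inter> X))"
      using q by (intro dvd_sum dvd) auto
    ultimately have "t dvd card (q \<inter> X)"
      using \<open>t dvd card X\<close> by (metis dvd_add_left_iff)
    moreover have "0 < card (q \<inter> X)"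
      using cq fin[OF qP] by (simp add: crosses_def card_gt_0_iff)
    moreover have "card (q \<inter> X) < card q"
      using cq fin[OF qP] by (intro psubset_card_mono) (auto simp: crosses_def)
    ultimately show False
      using t qP by (simp add: nat_dvd_not_less)
  qed
qed

text \<open>For partitions of \<open>V\<close>: no proper nonempty subset of \<open>V\<close> is a
  union of blocks of \<open>P\<close> and also of \<open>Q\<close>, so their join in the partition
  lattice is trivial.\<close>

definition jointly_connected :: "'a set \<Rightarrow> 'a set set \<Rightarrow> 'a set set \<Rightarrow> bool" where
  "jointly_connected V P Q \<longleftrightarrow>
     (\<forall>X. X \<subset> V \<and> X \<noteq> {} \<longrightarrow> (\<exists>e \<in> P \<union> Q. crosses X e))"

definition partition_hypergraph ::
  "'a set \<Rightarrow> nat \<Rightarrow> 'a set set \<Rightarrow> nat \<Rightarrow> 'a set set \<Rightarrow> nat \<Rightarrow> 'a set set \<Rightarrow> 'a hypergraph" where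
  "partition_hypergraph V a P b Q c R = \<lparr>verts = V,
     edges = repeat_mset a (mset_set P) + repeat_mset b (mset_set Q) + repeat_mset c (mset_set R)\<rparr>"

lemma filter_repeat_mset: "filter_mset f (repeat_mset n A) = repeat_mset n (filter_mset f A)"
  by (rule multiset_eqI) simp

text \<open>Here \<open>x\<close>, \<open>y\<close>, \<open>z\<close> stand for the numbers of
  crossed blocks in the three partitions. If all are positive, the sum is at least
  \<open>a + b + c\<close>; if, say, \<open>x = 0\<close>, it is at least
  \<open>2 * (b + c)\<close>, which is \<open>2 * (r - a)\<close> and hence at least
  \<open>r\<close>.\<close>

lemma weighted_crossing_bound:
  fixes a b c r x y z :: nat
  assumes "a + b + c = r" and "2 * a \<le> r" and "2 * b \<le> r" and "2 * c \<le> r"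
    and "x = 0 \<Longrightarrow> y \<ge> 2 \<and> z \<ge> 2" and "y = 0 \<Longrightarrow> x \<ge> 2 \<and> z \<ge> 2" and "z = 0 \<Longrightarrow> x \<ge> 2 \<and> y \<ge> 2"
  shows "r \<le> a * x + b * y + c * z"
proof -
  have mono: "a * i + b * j + c * k \<le> a * x + b * y + c * z" if "i \<le> x" "j \<le> y" "k \<le> z" for i j k
    using that by (intro add_mono mult_left_mono) auto
  consider "x \<ge> 1" "y \<ge> 1" "z \<ge> 1" | "x = 0" | "y = 0" | "z = 0"
    by linarith
  then show ?thesis
  proof cases
    case 1 then show ?thesis using mono[of 1 1 1] assms(1) by simp
  next
    case 2 then show ?thesis using mono[of 0 2 2] assms by simp
  next
    case 3 then show ?thesis using mono[of 2 0 2] assms by simp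
  next
    case 4 then show ?thesis using mono[of 2 2 0] assms by simp
  qed
qed

locale three_partitions =
  fixes V :: "'a set" and t :: nat and P Q R :: "'a set set"
  assumes fin: "finite V" and t2: "t \<ge> 2"
    and partition: "partition_on V P" "partition_on V Q" "partition_on V R"
    and blocks: "\<forall>p \<in> P \<union> Q \<union> R. card p = t"
    and joint: "jointly_connected V P Q" "jointly_connected V P R" "jointly_connected V Q R"
begin

lemma finite_partitions: "finite P" "finite Q" "finite R"
  using fin partition finite_elements by blast+

lemma edge_in:
  assumes "e \<in># edges (partition_hypergraph V a P b Q c R)"
  shows "e \<subseteq> V" and "card e = t"
proof -
  have e: "e \<in> P \<union> Q \<union> R"
    using assms finite_partitions
    by (auto simp: partition_hypergraph_def count_mset_set' simp flip: count_greater_zero_iff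
        split: if_splits)
  then show "e \<subseteq> V" using partition by (auto simp: partition_on_def)
  show "card e = t" using e blocks by blast
qed

lemma is_hypergraph: "is_hypergraph (partition_hypergraph V a P b Q c R)"
  using edge_in[of _ a b c] fin t2 by (simp add: is_hypergraph_def) (simp add: partition_hypergraph_def)

lemma uniform: "uniform t (partition_hypergraph V a P b Q c R)"
  using edge_in(2) by (auto simp: uniform_def)

lemma regular: "regular (a + b + c) (partition_hypergraph V a P b Q c R)"
proof -
  have one: "card {p \<in> S. v \<in> p} = 1" if S: "partition_on V S" and v: "v \<in> V" for S v
  proof -
    obtain p where p: "p \<in> S" "v \<in> p"
      using partition_onD1[OF S] v by auto
    then have "{p \<in> S. v \<in> p} = {p}"
      using partition_onD2[OF S] by (auto simp: disjoint_def)
    then show ?thesis by simp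
  qed
  show ?thesis
    unfolding regular_def partition_hypergraph_def
    using one[OF partition(1)] one[OF partition(2)] one[OF partition(3)] finite_partitions
    by (simp add: filter_repeat_mset)
qed

lemma edge_connected:
  assumes "a + b + c = r" and "2 * a \<le> r" and "2 * b \<le> r" and "2 * c \<le> r"
  shows "edge_connected r (partition_hypergraph V a P b Q c R)"
proof (rule edge_connectedI)
  show "\<forall>e \<in># edges (partition_hypergraph V a P b Q c R).
      e \<subseteq> verts (partition_hypergraph V a P b Q c R)"
    using edge_in(1) by (auto simp: partition_hypergraph_def)
next
  fix X assume "X \<subset> verts (partition_hypergraph V a P b Q c R)" and "X \<noteq> {}"
  then have X: "X \<subset> V \<and> X \<noteq> {}" by (simp add: partition_hypergraph_def)
  define n where "n S = card {p \<in> S. crosses X p}" for S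
  \<comment> \<open>When no block of \<open>S\<close> is crossed, joint connectivity rules out 0
    crossed blocks in \<open>S'\<close>, and divisibility of \<open>card X\<close> by
    \<open>t\<close> rules out exactly 1.\<close>
  have two: "n S' \<ge> 2" if "n S = 0" "jointly_connected V S S' \<or> jointly_connected V S' S"
    "S \<in> {P, Q, R}" "S' \<in> {P, Q, R}" for S S'
  proof -
    have S: "finite S" "finite S'" "partition_on V S" "partition_on V S'"
      "\<forall>p \<in> S. card p = t" "\<forall>p \<in> S'. card p = t"
      using that(3,4) finite_partitions partition blocks by auto
    have "\<exists>e \<in> S \<union> S'. crosses X e"
      using that(2) X unfolding jointly_connected_def by blast
    then have "n S' \<noteq> 0"
      using that(1) S(1,2) by (auto simp: n_def)
    moreover have "n S' \<noteq> 1"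
      using card_mod_crossing(1)[OF fin S(3,5)] card_mod_crossing(2)[OF fin S(4,6)] that(1) X
      by (auto simp: n_def)
    ultimately show ?thesis by linarith
  qed
  have "r \<le> a * n P + b * n Q + c * n R"
    using assms two[of P Q] two[of P R] two[of Q P] two[of Q R] two[of R P] two[of R Q] joint
    by (intro weighted_crossing_bound) auto
  then show "r \<le> size {#e \<in># edges (partition_hypergraph V a P b Q c R). crosses X e#}"
    using finite_partitions
    by (simp add: partition_hypergraph_def filter_repeat_mset n_def)
qed

end

section \<open>The partitions of the cyclic group\<close>

text \<open>Indexing by attained values only keeps the empty set out, as \<open>partition_on\<close>
  demands.\<close>

definition fibres :: "'a set \<Rightarrow> ('a \<Rightarrow> 'b) \<Rightarrow> 'a set set" where
  "fibres V f = (\<lambda>j. {v \<in> V. f v = j}) ` f ` V"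

lemma partition_on_fibres: "partition_on V (fibres V f)"
  by (auto simp: partition_on_def fibres_def disjoint_def)

lemma not_crosses_fibres:
  assumes "\<forall>e \<in> fibres V f. \<not> crosses X e" and "v \<in> V" and "w \<in> V" and "f v = f w"
  shows "v \<in> X \<longleftrightarrow> w \<in> X"
  using assms by (auto simp: fibres_def crosses_def)

lemma card_residue_class:
  fixes t m j :: nat
  assumes "j < m"
  shows "card {v \<in> {..<t * m}. v mod m = j} = t"
proof -
  have "bij_betw (\<lambda>v. v div m) {v \<in> {..<t * m}. v mod m = j} {..<t}"
  proof (rule bij_betw_byWitness[where f' = "\<lambda>i. i * m + j"])
    show "(\<lambda>i. i * m + j) ` {..<t} \<subseteq> {v \<in> {..<t * m}. v mod m = j}"
    proof (rule image_subsetI)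
      fix i assume "i \<in> {..<t}"
      then have "Suc i * m \<le> t * m" by (intro mult_le_mono1) simp
      then show "i * m + j \<in> {v \<in> {..<t * m}. v mod m = j}" using assms by simp
    qed
  qed (use assms in \<open>auto simp: less_mult_imp_div_less\<close>)
  then show ?thesis by (simp add: bij_betw_same_card)
qed

text \<open>Translation by \<open>s\<close> modulo \<open>t * m\<close> permutes
  \<open>{..<t * m}\<close> and carries the set in question onto the interval
  \<open>{j * t..<Suc j * t}\<close>.\<close>

lemma card_translated_interval:
  fixes t m j s :: nat
  assumes "t > 0" and "j < m"
  shows "card {v \<in> {..<t * m}. (v + s) div t mod m = j} = t"
proof -
  define g where "g v = (v + s) mod (t * m)" for v
  have n: "t * m > 0" using assms by simp
  have inj: "inj_on g {..<t * m}"
  proof (rule linorder_inj_onI)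
    fix v w assume "v < w" "v \<in> {..<t * m}" "w \<in> {..<t * m}"
    moreover have "t * m dvd w - v" if "g w = g v"
      using that \<open>v < w\<close> mod_eq_dvd_iff_nat[of "v + s" "w + s" "t * m"] by (simp add: g_def)
    ultimately show "g v \<noteq> g w"
      using dvd_imp_le[of "t * m" "w - v"] by force
  qed auto
  then have surj: "g ` {..<t * m} = {..<t * m}"
    using n by (intro endo_inj_surj) (auto simp: g_def)
  \<comment> \<open>Reducing modulo \<open>t * m\<close> before dividing by \<open>t\<close> amounts
    to reducing the quotient modulo \<open>m\<close>.\<close>
  have "(v + s) div t mod m = g v div t" for v
    using assms(1) by (simp add: g_def mod_mult2_eq)
  then have "g ` {v \<in> {..<t * m}. (v + s) div t mod m = j} = {w \<in> g ` {..<t * m}. w div t = j}"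
    by auto
  also have "\<dots> = {j * t..<Suc j * t}"
  proof -
    have "Suc j * t \<le> m * t" using assms(2) by (intro mult_le_mono1) simp
    then show ?thesis
      unfolding surj using assms(1)
      by (auto simp: div_nat_eqI mult.commute[of t] intro: div_times_less_eq_dividend dividend_less_div_times)
  qed
  finally have "card (g ` {v \<in> {..<t * m}. (v + s) div t mod m = j}) = t"
    by simp
  then show ?thesis
    using card_image[OF inj_on_subset[OF inj]] by (metis (no_types, lifting) mem_Collect_eq subsetI)
qed

text \<open>Intervals of length \<open>t\<close> in the cyclic group of order \<open>t * m\<close>,
  translated by \<open>-s\<close>; the final \<open>mod m\<close> closes the cycle by joining the
  two ends of an interval that wraps around.\<close>

definition blocks :: "nat \<Rightarrow> nat \<Rightarrow> nat \<Rightarrow> nat set set" where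
  "blocks t m s = fibres {..<t * m} (\<lambda>v. (v + s) div t mod m)"

text \<open>Since \<open>m\<close> divides \<open>t * m\<close>, the residue modulo \<open>m\<close>
  identifies the coset of the subgroup generated by \<open>m\<close>.\<close>

definition cosets :: "nat \<Rightarrow> nat \<Rightarrow> nat set set" where
  "cosets t m = fibres {..<t * m} (\<lambda>v. v mod m)"

text \<open>A step from \<open>i\<close> to \<open>Suc i\<close> enters a new block only when
  \<open>t\<close> divides \<open>Suc (i + s)\<close>.\<close>

lemma not_crosses_blocks:
  assumes "\<forall>e \<in> blocks t m s. \<not> crosses X e" and "t * m > 0" and "\<not> t dvd Suc (i + s)"
  shows "i mod (t * m) \<in> X \<longleftrightarrow> Suc i mod (t * m) \<in> X"
proof -
  \<comment> \<open>The block index has period \<open>t * m\<close>, since adding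
    \<open>t * m\<close> raises the quotient by \<open>m\<close>; it can therefore be computed from
    \<open>i\<close> itself.\<close>
  have per: "(i mod (t * m) + s) div t mod m = (i + s) div t mod m" for i
  proof -
    have "(i + s) div t mod m = (i mod (t * m) + s + t * (m * (i div (t * m)))) div t mod m"
      by (metis add.assoc add.commute mult.assoc mult_div_mod_eq)
    also have "\<dots> = ((i mod (t * m) + s) div t + m * (i div (t * m))) mod m"
      using assms(2) by simp
    finally show ?thesis by simp
  qed
  have "Suc (i + s) div t = (i + s) div t"
    using assms(3) by (simp add: div_Suc dvd_eq_mod_eq_0)
  then show ?thesis
    using assms(2) per[of i] per[of "Suc i"]
    by (intro not_crosses_fibres[OF assms(1)[unfolded blocks_def]]) auto
qed

lemma not_crosses_cosets:
  assumes "\<forall>e \<in> cosets t m. \<not> crosses X e" and "t * m > 0"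
  shows "i mod (t * m) \<in> X \<longleftrightarrow> (i + m) mod (t * m) \<in> X"
  using assms(2)
  by (intro not_crosses_fibres[OF assms(1)[unfolded cosets_def]]) (auto simp: mod_mod_cancel)

text \<open>Membership in an uncrossed \<open>X\<close> is constant along a walk around the cycle,
  so \<open>X\<close> is empty or everything.\<close>

lemma jointly_connected_if_successors:
  fixes n :: nat
  assumes "\<And>X i. n > 0 \<Longrightarrow> (\<forall>e \<in> P \<union> Q. \<not> crosses X e) \<Longrightarrow> i mod n \<in> X \<longleftrightarrow> Suc i mod n \<in> X"
  shows "jointly_connected {..<n} P Q"
  unfolding jointly_connected_def
proof (intro allI impI, rule ccontr)
  fix X assume X: "X \<subset> {..<n} \<and> X \<noteq> {}" and no: "\<not> (\<exists>e \<in> P \<union> Q. crosses X e)"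
  then have "n > 0" by (cases n) auto
  then have step: "i mod n \<in> X \<longleftrightarrow> Suc i mod n \<in> X" for i
    using assms[of X i] no by blast
  have const: "i mod n \<in> X \<longleftrightarrow> 0 \<in> X" for i
    by (induction i) (use step in auto)
  have "i \<in> X \<longleftrightarrow> 0 \<in> X" if "i < n" for i
    using const[of i] that by simp
  then show False using X by auto
qed

lemma jointly_connected_blocks:
  assumes "t \<ge> 2"
  shows "jointly_connected {..<t * m} (blocks t m 0) (blocks t m 1)"
proof (rule jointly_connected_if_successors)
  fix X i assume *: "0 < t * m" "\<forall>e \<in> blocks t m 0 \<union> blocks t m 1. \<not> crosses X e"
  \<comment> \<open>Two consecutive numbers are not both multiples of \<open>t\<close>, so at least
    one of the two partitions keeps \<open>i\<close> and \<open>Suc i\<close> in one block.\<close>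
  have "\<not> (t dvd Suc i \<and> t dvd Suc (i + 1))"
    using assms dvd_add_right_iff[of t "Suc i" 1] by auto
  then show "i mod (t * m) \<in> X \<longleftrightarrow> Suc i mod (t * m) \<in> X"
    using not_crosses_blocks[of t m 0 X i] not_crosses_blocks[of t m 1 X i] * by auto
qed

lemma jointly_connected_blocks_cosets:
  assumes "\<not> t dvd m"
  shows "jointly_connected {..<t * m} (blocks t m s) (cosets t m)"
proof (rule jointly_connected_if_successors)
  fix X i assume *: "0 < t * m" "\<forall>e \<in> blocks t m s \<union> cosets t m. \<not> crosses X e"
  have b: "j mod (t * m) \<in> X \<longleftrightarrow> Suc j mod (t * m) \<in> X" if "\<not> t dvd Suc (j + s)" for j
    using not_crosses_blocks * that by blast
  have c: "j mod (t * m) \<in> X \<longleftrightarrow> (j + m) mod (t * m) \<in> X" for j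
    using not_crosses_cosets * by blast
  show "i mod (t * m) \<in> X \<longleftrightarrow> Suc i mod (t * m) \<in> X"
  proof (cases "t dvd Suc (i + s)")
    \<comment> \<open>A block boundary after \<open>i\<close> is bypassed by the detour
      \<open>i\<close>, \<open>i + m\<close>, \<open>Suc (i + m)\<close>, \<open>Suc i\<close>: the
      outer moves stay in a coset, and the middle one stays in a block because \<open>t\<close> does
      not divide \<open>m\<close>.\<close>
    case True
    then have "\<not> t dvd Suc (i + m + s)"
      using assms dvd_add_right_iff[of t "Suc (i + s)" m] by (simp add: ac_simps)
    then show ?thesis
      using b[of "i + m"] c[of i] c[of "Suc i"] by simp
  qed (rule b)
qed

lemma three_partitions_cyclic:
  assumes "t \<ge> 2" and "\<not> t dvd m"
  shows "three_partitions {..<t * m} t (blocks t m 0) (blocks t m 1) (cosets t m)"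
proof
  have "m > 0" using assms(2) by (cases m) auto
  then show "\<forall>p \<in> blocks t m 0 \<union> blocks t m 1 \<union> cosets t m. card p = t"
    using assms(1) card_translated_interval[of t _ m 0] card_translated_interval[of t _ m 1]
      card_residue_class[of _ m t]
    by (auto simp: blocks_def cosets_def fibres_def)
  show "partition_on {..<t * m} (blocks t m 0)" "partition_on {..<t * m} (blocks t m 1)"
    "partition_on {..<t * m} (cosets t m)"
    by (simp_all add: blocks_def cosets_def partition_on_fibres)
qed (use assms jointly_connected_blocks jointly_connected_blocks_cosets in auto)

section \<open>The infinite family\<close>

theorem theorem4:
  fixes r t :: nat
  assumes "r \<ge> 2" and "t \<ge> 2"
  shows "\<exists>S :: nat hypergraph set. infinite S \<and>
    pairwise (\<lambda>H H'. \<not> isomorphic H H') S \<and>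
    (\<forall>H \<in> S. is_hypergraph H \<and> edge_connected r H \<and> regular r H \<and> uniform t H \<and>
       (\<forall>k :: nat. real k > 2 / real t * real r \<longrightarrow> \<not> (\<exists>H'. berge_factor k H' H)))"
proof -
  \<comment> \<open>This choice makes \<open>m s\<close> congruent to 1 modulo \<open>t\<close>,
    hence not divisible by \<open>t\<close>.\<close>
  define m where "m s = t * s + 1" for s
  \<comment> \<open>The weights sum to \<open>r\<close>, and each is at most half of
    \<open>r\<close>; for \<open>r mod 2\<close> this uses \<open>r \<ge> 2\<close>.\<close>
  define F where "F s = partition_hypergraph {..<t * m s} (r div 2) (blocks t (m s) 0)
    (r div 2) (blocks t (m s) 1) (r mod 2) (cosets t (m s))" for s
  have card: "card (verts (F s)) = t * m s" for s
    by (simp add: F_def partition_hypergraph_def)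
  \<comment> \<open>The order \<open>t * (t * s + 1)\<close> determines \<open>s\<close>, which
    gives both infinitude and pairwise non-isomorphism.\<close>
  have inj: "s = s'" if "card (verts (F s)) = card (verts (F s'))" for s s'
    using that assms(2) by (simp add: card m_def)
  have props: "is_hypergraph (F s) \<and> edge_connected r (F s) \<and> regular r (F s) \<and> uniform t (F s)" for s
  proof -
    have "\<not> t dvd m s"
      using assms(2) dvd_add_right_iff[of t "t * s" 1] by (auto simp: m_def)
    then interpret three_partitions "{..<t * m s}" t "blocks t (m s) 0" "blocks t (m s) 1" "cosets t (m s)"
      using assms(2) by (rule three_partitions_cyclic[rotated])
    have "r div 2 + r div 2 + r mod 2 = r" by presburger
    moreover have "2 * (r mod 2) \<le> r" using assms(1) by presburger
    ultimately show ?thesis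
      using is_hypergraph uniform edge_connected[of "r div 2" "r div 2" "r mod 2" r]
        regular[of "r div 2" "r div 2" "r mod 2"]
      by (simp add: F_def)
  qed
  have no_factor: "\<not> berge_factor k H' (F s)" if k: "real k > 2 / real t * real r" for k H' s
  proof
    assume "berge_factor k H' (F s)"
    moreover have "verts (F s) \<noteq> {}"
      using card[of s] assms(2) by (auto simp: m_def)
    ultimately have "k * t \<le> 2 * r"
      using berge_factor_bound props by blast
    then have "real k * real t \<le> 2 * real r"
      by (metis of_nat_le_iff of_nat_mult of_nat_numeral)
    then show False
      using k assms(2) by (simp add: field_simps)
  qed
  have "infinite (range F)"
    using inj by (metis finite_imageD infinite_UNIV_nat injI)
  moreover have "pairwise (\<lambda>H H'. \<not> isomorphic H H') (range F)"
    using inj by (auto simp: pairwise_def isomorphic_def dest: bij_betw_same_card)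
  ultimately show ?thesis
    using props no_factor by (intro exI[of _ "range F"]) auto
qed

end
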